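(* Let $(X,\|\cdot\|)$ be a (real) reflexive Banach space and let $K_{f,\varepsilon}$ be an ice cream cone in $X$. Then every interior point of $K_{f,\varepsilon}$ with respect to the norm topology is a net catching element of the partially ordered vector space $(X,K_{f,\varepsilon})$.
   Context: Let $f$ be a linear functional on $X$ with $\|f\|:=\sup\{|f(x)|/\|x\|;\ x\in X\setminus\{0\}\}=1$ and let $\varepsilon\in(0,1)$. The ice cream cone with parameters $f$ and $\varepsilon$ is $K_{f,\varepsilon}:=\{x\in X;\ f(x)\geq\varepsilon\|x\|\}$. $(X,K_{f,\varepsilon})$ denotes $X$ with the partial order $x\leq y :\Leftrightarrow y-x\in K_{f,\varepsilon}$. For a net $(x_\alpha)_{\alpha\in A}$ in a partially ordered vector space we write $x_\alpha\downarrow 0$ if the net is decreasing ($\alpha\leq\beta$ implies $x_\beta\leq x_\alpha$) and $\inf_{\alpha\in A} x_\alpha=0$. An element $y$ is called net catching if for every net $(x_\alpha)_{\alpha\in A}$ with $x_\alpha\downarrow 0$ there is $\alpha\in A$ with $x_\alpha\leq y$. *)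

theory Defs
  imports "HOL-Analysis.Analysis"
begin

lift_definition bidual_embedding ::
    "'a::real_normed_vector \<Rightarrow> ('a \<Rightarrow>\<^sub>L real) \<Rightarrow>\<^sub>L real"
  is "\<lambda>x g. blinfun_apply g x"
  by (rule blinfun.bounded_linear_left)

definition reflexive_space :: "'a::real_normed_vector itself \<Rightarrow> bool" where
  "reflexive_space _ \<longleftrightarrow>
     surj (bidual_embedding :: 'a \<Rightarrow> ('a \<Rightarrow>\<^sub>L real) \<Rightarrow>\<^sub>L real)"

definition ice_cream_cone ::
    "('a::real_normed_vector \<Rightarrow>\<^sub>L real) \<Rightarrow> real \<Rightarrow> 'a set" where
  "ice_cream_cone f \<epsilon> = {x. blinfun_apply f x \<ge> \<epsilon> * norm x}"

definition cone_le :: "'a::real_vector set \<Rightarrow> 'a \<Rightarrow> 'a \<Rightarrow> bool" where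
  "cone_le K x y \<longleftrightarrow> y - x \<in> K"

definition is_infimum :: "('a \<Rightarrow> 'a \<Rightarrow> bool) \<Rightarrow> 'a set \<Rightarrow> 'a \<Rightarrow> bool" where
  "is_infimum le S m \<longleftrightarrow>
     (\<forall>s\<in>S. le m s) \<and> (\<forall>z. (\<forall>s\<in>S. le z s) \<longrightarrow> le z m)"

definition directed_index :: "'i set \<Rightarrow> 'i rel \<Rightarrow> bool" where
  "directed_index A r \<longleftrightarrow> A \<noteq> {} \<and> preorder_on A r \<and>
     (\<forall>\<alpha>\<in>A. \<forall>\<beta>\<in>A. \<exists>\<gamma>\<in>A. (\<alpha>, \<gamma>) \<in> r \<and> (\<beta>, \<gamma>) \<in> r)"

definition net_decreasing_to_zero ::
    "('a::real_vector \<Rightarrow> 'a \<Rightarrow> bool) \<Rightarrow> 'i set \<Rightarrow> 'i rel \<Rightarrow> ('i \<Rightarrow> 'a) \<Rightarrow> bool" where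
  "net_decreasing_to_zero le A r x \<longleftrightarrow>
     (\<forall>\<alpha>\<in>A. \<forall>\<beta>\<in>A. (\<alpha>, \<beta>) \<in> r \<longrightarrow> le (x \<beta>) (x \<alpha>)) \<and> is_infimum le (x ` A) 0"

(* Nets are indexed by subsets of the type 'i. As HOL cannot quantify over types inside a
   formula, 'i is a parameter; "net catching" means that the predicate holds for every 'i,
   i.e. that it is stated with a type variable 'i not otherwise constrained. *)
definition net_catching ::
    "'i itself \<Rightarrow> ('a::real_vector \<Rightarrow> 'a \<Rightarrow> bool) \<Rightarrow> 'a \<Rightarrow> bool" where
  "net_catching _ le y \<longleftrightarrow>
     (\<forall>(A :: 'i set) r x. directed_index A r \<and> net_decreasing_to_zero le A r x \<longrightarrow>
        (\<exists>\<alpha>\<in>A. le (x \<alpha>) y))"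

lemma partial_order_ice_cream_cone:
  assumes "0 < \<epsilon>"
  shows "partial_order_on UNIV {(x, y). cone_le (ice_cream_cone f \<epsilon>) x y}"
proof -
  let ?le = "cone_le (ice_cream_cone f \<epsilon>)"
  have "?le x z" if "?le x y" "?le y z" for x y z
  proof -
    have "\<epsilon> * norm (z - x) \<le> \<epsilon> * (norm (z - y) + norm (y - x))"
      using assms norm_triangle_ineq[of "z - y" "y - x"] by (intro mult_left_mono) auto
    then show ?thesis
      using that by (simp add: cone_le_def ice_cream_cone_def blinfun.diff_right distrib_left)
  qed
  moreover have "x = y" if "?le x y" "?le y x" for x y
  proof -
    have "\<epsilon> * norm (y - x) \<le> 0"
      using that by (simp add: cone_le_def ice_cream_cone_def blinfun.diff_right norm_minus_commute)
    then show ?thesis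
      using assms by (simp add: mult_le_0_iff)
  qed
  ultimately show ?thesis
    unfolding partial_order_on_def preorder_on_def refl_on_def trans_def antisym_def
    by (auto simp: cone_le_def ice_cream_cone_def blinfun.zero_right)
qed

end

theory Submission
  imports Defs
begin

text \<open>
  If \<open>z \<le> x\<close> then \<open>\<epsilon> * norm (x - z) \<le> f x - f z\<close>, so a decreasing net that is bounded below is
  Cauchy in norm because its image under \<open>f\<close> is a bounded decreasing net of reals. As the cone is
  closed, the norm limit of a net decreasing to \<open>0\<close> is \<open>0\<close>, and \<open>y - x \<alpha>\<close> enters the interior
  of the cone.
\<close>

lemma cone_le_ice_cream_cone_iff:
  "cone_le (ice_cream_cone f \<epsilon>) x y \<longleftrightarrow> \<epsilon> * norm (y - x) \<le> f y - f x"
  by (simp add: cone_le_def ice_cream_cone_def blinfun.diff_right)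

lemma closed_ice_cream_cone: "closed (ice_cream_cone f \<epsilon>)"
  unfolding ice_cream_cone_def by (intro closed_Collect_le continuous_intros)

lemma tendsto_cone_le:
  fixes K :: "'a::real_normed_vector set"
  assumes "closed K" "X \<longlonglongrightarrow> a" "\<And>n::nat. cone_le K (X n) b"
  shows "cone_le K a b"
  using closed_sequentially[OF assms(1) _ tendsto_diff[OF tendsto_const assms(2)], of b] assms(3)
  by (simp add: cone_le_def)

text \<open>A sequence suffices even if the net has no cofinal sequence: the indices
  \<open>a n\<close> are chosen only so that \<open>f (x (a n))\<close> approaches the infimum of
  \<open>f\<close> along the net, and they need be neither increasing nor cofinal. Directedness
  makes up for this through common upper bounds.\<close>

lemma decreasing_net_convergent_ice_cream_cone:
  fixes f :: "'a::banach \<Rightarrow>\<^sub>L real" and \<epsilon> :: real and x :: "'i \<Rightarrow> 'a"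
  defines "le \<equiv> cone_le (ice_cream_cone f \<epsilon>)"
  assumes "0 < \<epsilon>" and A: "directed_index A r"
    and decr: "\<And>\<alpha> \<beta>. \<alpha> \<in> A \<Longrightarrow> \<beta> \<in> A \<Longrightarrow> (\<alpha>, \<beta>) \<in> r \<Longrightarrow> le (x \<beta>) (x \<alpha>)"
    and lower: "\<And>\<alpha>. \<alpha> \<in> A \<Longrightarrow> le b (x \<alpha>)"
  obtains a l where "range a \<subseteq> A" "(\<lambda>n::nat. x (a n)) \<longlonglongrightarrow> l" "\<And>\<alpha>. \<alpha> \<in> A \<Longrightarrow> le l (x \<alpha>)"
proof -
  have le_iff: "le u v \<longleftrightarrow> \<epsilon> * norm (v - u) \<le> f v - f u" for u v
    by (simp add: le_def cone_le_ice_cream_cone_iff)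
  have upper: "\<exists>\<gamma>\<in>A. (\<alpha>, \<gamma>) \<in> r \<and> (\<beta>, \<gamma>) \<in> r" if "\<alpha> \<in> A" "\<beta> \<in> A" for \<alpha> \<beta>
    using A that by (auto simp: directed_index_def)
  \<comment> \<open>Since \<open>f\<close> is nonnegative on the cone, it is monotone for
    \<open>le\<close>. Hence \<open>f b\<close> bounds its values on the net from below, and
    \<open>c\<close> is a genuine infimum.\<close>
  define c where "c = (INF \<alpha>\<in>A. f (x \<alpha>))"
  have "f b \<le> f (x \<alpha>)" if "\<alpha> \<in> A" for \<alpha>
    using lower[OF that] \<open>0 < \<epsilon>\<close> unfolding le_iff
    by (smt (verit) mult_nonneg_nonneg norm_ge_zero)
  then have bdd: "bdd_below ((\<lambda>\<alpha>. f (x \<alpha>)) ` A)"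
    by (auto intro!: bdd_belowI[of _ "f b"])
  have c_le: "c \<le> f (x \<alpha>)" if "\<alpha> \<in> A" for \<alpha>
    unfolding c_def by (rule cINF_lower[OF bdd that])
  have "\<exists>\<alpha>\<in>A. f (x \<alpha>) < c + inverse (real (Suc n))" for n
    using cINF_less_iff[OF _ bdd, of "c + inverse (real (Suc n))"] A
    by (auto simp: c_def directed_index_def)
  then obtain a where a: "a n \<in> A" "f (x (a n)) < c + inverse (real (Suc n))" for n
    by metis
  \<comment> \<open>Beyond \<open>a n\<close> the value of \<open>f\<close> stays at least
    \<open>c\<close>, so it drops by less than \<open>inverse (real (Suc n))\<close>. The cone
    inequality turns this drop into a norm bound at the cost of the factor 1/\<epsilon>.\<close>
  have near: "norm (x (a n) - x \<gamma>) \<le> inverse (real (Suc n)) / \<epsilon>" if "\<gamma> \<in> A" "(a n, \<gamma>) \<in> r" for n \<gamma>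
  proof -
    have "norm (x (a n) - x \<gamma>) * \<epsilon> \<le> inverse (real (Suc n))"
      using decr[OF a(1) that] a(2)[of n] c_le[OF that(1)]
      unfolding le_iff mult.commute[of \<epsilon>] by linarith
    then show ?thesis
      using \<open>0 < \<epsilon>\<close> by (simp add: pos_le_divide_eq)
  qed
  have null: "(\<lambda>n. inverse (real (Suc n)) / \<epsilon>) \<longlonglongrightarrow> 0"
    using tendsto_divide[OF LIMSEQ_inverse_real_of_nat tendsto_const, of \<epsilon>] \<open>0 < \<epsilon>\<close> by simp
  have "Cauchy (\<lambda>n. x (a n))"
  proof (rule metric_CauchyI)
    fix e :: real assume "0 < e"
    then have "\<forall>\<^sub>F n in sequentially. inverse (real (Suc n)) / \<epsilon> < e / 2"
      using order_tendstoD(2)[OF null, of "e / 2"] by simp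
    then obtain N where N: "inverse (real (Suc n)) / \<epsilon> < e / 2" if "n \<ge> N" for n
      by (auto simp: eventually_sequentially)
    have "dist (x (a m)) (x (a n)) < e" if "m \<ge> N" "n \<ge> N" for m n
    proof -
      \<comment> \<open>The indices \<open>a m\<close> and \<open>a n\<close> may be incomparable,
        so both terms are compared with the term at a common upper bound.\<close>
      obtain \<gamma> where \<gamma>: "\<gamma> \<in> A" "(a m, \<gamma>) \<in> r" "(a n, \<gamma>) \<in> r"
        using upper a(1) by blast
      have "dist (x (a m)) (x \<gamma>) < e / 2" "dist (x (a n)) (x \<gamma>) < e / 2"
        using near[OF \<gamma>(1,2)] near[OF \<gamma>(1,3)] N[OF that(1)] N[OF that(2)]
        unfolding dist_norm by linarith+
      then show ?thesis
        by (rule dist_triangle_half_l)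
    qed
    then show "\<exists>M. \<forall>m\<ge>M. \<forall>n\<ge>M. dist (x (a m)) (x (a n)) < e"
      by blast
  qed
  then obtain l where l: "(\<lambda>n. x (a n)) \<longlonglongrightarrow> l"
    by (auto simp: Cauchy_convergent_iff convergent_def)
  have "le l (x \<alpha>)" if \<alpha>: "\<alpha> \<in> A" for \<alpha>
  proof -
    \<comment> \<open>No \<open>a n\<close> need lie above \<alpha>, so the sequence is replaced by
      one that does: being beyond \<open>a n\<close>, the index \<open>g n\<close> leaves the limit
      unchanged by \<open>near\<close>, and being beyond \<alpha>, it gives terms below
      \<open>x \<alpha>\<close>.\<close>
    obtain g where g: "g n \<in> A" "(\<alpha>, g n) \<in> r" "(a n, g n) \<in> r" for n
      using upper[OF \<alpha> a(1)] by metis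
    have "(\<lambda>n. x (a n) - x (g n)) \<longlonglongrightarrow> 0"
      by (rule Lim_null_comparison[OF always_eventually null]) (use near g in auto)
    from tendsto_diff[OF l this] have "(\<lambda>n. x (g n)) \<longlonglongrightarrow> l"
      by simp
    then show ?thesis
      unfolding le_def
      by (rule tendsto_cone_le[OF closed_ice_cream_cone])
        (use decr[OF \<alpha> g(1,2)] in \<open>simp add: le_def\<close>)
  qed
  with a(1) l show thesis
    by (auto intro: that)
qed

theorem proposition5p8:
  fixes f :: "'a::banach \<Rightarrow>\<^sub>L real" and \<epsilon> :: real and y :: 'a
  assumes "reflexive_space TYPE('a)"
    and "norm f = 1"
    and "0 < \<epsilon>" and "\<epsilon> < 1"
    and "y \<in> interior (ice_cream_cone f \<epsilon>)"
  shows "net_catching TYPE('i) (cone_le (ice_cream_cone f \<epsilon>)) y"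
  unfolding net_catching_def
proof (intro allI impI)
  fix A :: "'i set" and r x
  let ?K = "ice_cream_cone f \<epsilon>"
  assume "directed_index A r \<and> net_decreasing_to_zero (cone_le ?K) A r x"
  then have A: "directed_index A r"
    and decr: "\<And>\<alpha> \<beta>. \<alpha> \<in> A \<Longrightarrow> \<beta> \<in> A \<Longrightarrow> (\<alpha>, \<beta>) \<in> r \<Longrightarrow> cone_le ?K (x \<beta>) (x \<alpha>)"
    and lower: "\<And>\<alpha>. \<alpha> \<in> A \<Longrightarrow> cone_le ?K 0 (x \<alpha>)"
    and greatest: "\<And>z. (\<And>\<alpha>. \<alpha> \<in> A \<Longrightarrow> cone_le ?K z (x \<alpha>)) \<Longrightarrow> cone_le ?K z 0"
    by (auto simp: net_decreasing_to_zero_def is_infimum_def)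
  \<comment> \<open>The infimum 0 serves as the lower bound \<open>b\<close>.\<close>
  obtain a l where a: "range a \<subseteq> A" and l: "(\<lambda>n::nat. x (a n)) \<longlonglongrightarrow> l"
    and l_le: "\<And>\<alpha>. \<alpha> \<in> A \<Longrightarrow> cone_le ?K l (x \<alpha>)"
    by (rule decreasing_net_convergent_ice_cream_cone[OF \<open>0 < \<epsilon>\<close> A, of f x 0])
      (use decr lower in auto)
  have "l \<in> ?K"
    by (rule closed_sequentially[OF closed_ice_cream_cone _ l])
      (use a lower in \<open>auto simp: cone_le_def\<close>)
  then have "cone_le ?K 0 l"
    by (simp add: cone_le_def)
  \<comment> \<open>As \<open>l\<close> is itself a lower bound of the net, it lies below the
    greatest one.\<close>
  moreover have "cone_le ?K l 0"
    using greatest l_le by blast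
  ultimately have "l = 0"
    using partial_order_ice_cream_cone[OF \<open>0 < \<epsilon>\<close>, of f]
    by (auto simp: partial_order_on_def antisym_def)
  with tendsto_diff[OF tendsto_const l, of y] have "(\<lambda>n. y - x (a n)) \<longlonglongrightarrow> y"
    by simp
  then have "\<forall>\<^sub>F n in sequentially. y - x (a n) \<in> interior ?K"
    using assms(5) by (intro topological_tendstoD) auto
  then obtain n where "y - x (a n) \<in> interior ?K"
    by (auto simp: eventually_sequentially)
  then have "cone_le ?K (x (a n)) y"
    using interior_subset by (auto simp: cone_le_def)
  with a show "\<exists>\<alpha>\<in>A. cone_le ?K (x \<alpha>) y"
    by blast
qed

end
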